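(* Let $\hbar>0$, $n\geq1$, and let $\Sigma$ be a real symmetric $2n\times 2n$ matrix such that the Hermitian matrix $\Sigma+\frac{i\hbar}{2}J$ is positive semidefinite, where $J=\begin{pmatrix}0_{n\times n}&I_{n\times n}\\-I_{n\times n}&0_{n\times n}\end{pmatrix}$ (so $\Sigma$ is positive definite). Let $\Omega_\Sigma=\{z\in\mathbb{R}^{2n}:\tfrac12 z^T\Sigma^{-1}z\leq1\}$, and let $X\subset\mathbb{R}^n_x$ and $P\subset\mathbb{R}^n_p$ be the orthogonal projections of $\Omega_\Sigma$ onto the position space $\mathbb{R}^n_x$ and momentum space $\mathbb{R}^n_p$ respectively, where $\mathbb{R}^{2n}=\mathbb{R}^n_x\times\mathbb{R}^n_p$. Then $(X,P)$ is a $\hbar$-polar quantum pair, i.e. $X^{\hbar}\subset P$, and hence $c_{\mathrm{HZ}}(X\times P)\geq 4\hbar$.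
   Context: For a centrally symmetric convex body $X\subset\mathbb{R}^n_x$ (compact convex with nonempty interior, $X=-X$), its $\hbar$-polar set is $X^{\hbar}=\{p\in\mathbb{R}^n_p: p^Tx\leq\hbar\text{ for all }x\in X\}$; a pair $(X,P)$ of such bodies is a $\hbar$-polar quantum pair if $X^{\hbar}\subset P$. Phase space $\mathbb{R}^{2n}$ carries the standard symplectic form $\sigma(z,z')=(z')^TJz$. $c_{\mathrm{HZ}}$ denotes the Hofer–Zehnder symplectic capacity; for a compact convex set with nonempty interior it equals the minimal (positive) action $\oint p\,dx$ among closed characteristics (periodic Hamiltonian orbits) on its boundary. *)

theory Defs
  imports "HOL-Analysis.Analysis"
begin

text \<open>Phase space R^{2n} = R^n_x \<times> R^n_p is modelled as real^('n + 'n):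
  coordinates Inl i are positions x_i, coordinates Inr i are momenta p_i.\<close>

definition xpart :: "real^('n::finite + 'n) \<Rightarrow> real^'n" where
  "xpart z = (\<chi> i. z $ Inl i)"

definition ppart :: "real^('n::finite + 'n) \<Rightarrow> real^'n" where
  "ppart z = (\<chi> i. z $ Inr i)"

definition Jmat :: "real^('n::finite + 'n)^('n + 'n)" where
  "Jmat = (\<chi> i j. case (i, j) of
      (Inl a, Inr b) \<Rightarrow> (if a = b then 1 else 0)
    | (Inr a, Inl b) \<Rightarrow> (if a = b then -1 else 0)
    | _ \<Rightarrow> 0)"

definition hermitian_psd :: "complex^'m::finite^'m \<Rightarrow> bool" where
  "hermitian_psd M \<longleftrightarrow> (\<forall>i j. M $ i $ j = cnj (M $ j $ i)) \<and>
     (\<forall>w :: complex^'m. (\<Sum>i\<in>UNIV. \<Sum>j\<in>UNIV. cnj (w $ i) * M $ i $ j * w $ j) \<in> \<real> \<and>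
                         0 \<le> Re (\<Sum>i\<in>UNIV. \<Sum>j\<in>UNIV. cnj (w $ i) * M $ i $ j * w $ j))"

definition sym_convex_body :: "('a::euclidean_space) set \<Rightarrow> bool" where
  "sym_convex_body X \<longleftrightarrow> compact X \<and> convex X \<and> interior X \<noteq> {} \<and> uminus ` X = X"

definition hbar_polar :: "real \<Rightarrow> (real^'n::finite) set \<Rightarrow> (real^'n) set" where
  "hbar_polar hbar X = {p. \<forall>x\<in>X. p \<bullet> x \<le> hbar}"

definition hbar_polar_quantum_pair :: "real \<Rightarrow> (real^'n::finite) set \<Rightarrow> (real^'n) set \<Rightarrow> bool" where
  "hbar_polar_quantum_pair hbar X P \<longleftrightarrow>
     sym_convex_body X \<and> sym_convex_body P \<and> hbar_polar hbar X \<subseteq> P"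

definition phase_product :: "(real^'n::finite) set \<Rightarrow> (real^'n) set \<Rightarrow> (real^('n + 'n)) set" where
  "phase_product X P = {z. xpart z \<in> X \<and> ppart z \<in> P}"

definition normal_cone :: "('a::real_inner) set \<Rightarrow> 'a \<Rightarrow> 'a set" where
  "normal_cone K z = {v. \<forall>y\<in>K. v \<bullet> (y - z) \<le> 0}"

text \<open>Generalized closed characteristic on the boundary of a convex body K
  (Clarke): a nonconstant Lipschitz loop gamma on [0,T] lying in the boundary of K
  whose derivative v satisfies gamma'(t) \<in> J N_K(gamma(t)) for almost every t.\<close>
definition closed_characteristic ::
  "(real^('n::finite + 'n)) set \<Rightarrow> real \<Rightarrow> (real \<Rightarrow> real^('n + 'n)) \<Rightarrow> (real \<Rightarrow> real^('n + 'n)) \<Rightarrow> bool" where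
  "closed_characteristic K T \<gamma> v \<longleftrightarrow>
     0 < T \<and> (\<exists>L. L-lipschitz_on {0..T} \<gamma>) \<and> \<gamma> 0 = \<gamma> T \<and>
     (\<forall>t\<in>{0..T}. \<gamma> t \<in> frontier K) \<and> (\<exists>t\<in>{0..T}. \<gamma> t \<noteq> \<gamma> 0) \<and>
     (\<exists>N. N \<in> null_sets lborel \<and>
        (\<forall>t\<in>{0..T} - N. (\<gamma> has_vector_derivative v t) (at t) \<and>
                         v t \<in> (\<lambda>w. Jmat *v w) ` normal_cone K (\<gamma> t)))"

definition action :: "real \<Rightarrow> (real \<Rightarrow> real^('n::finite + 'n)) \<Rightarrow> (real \<Rightarrow> real^('n + 'n)) \<Rightarrow> real" where
  "action T \<gamma> v = integral {0..T} (\<lambda>t. ppart (\<gamma> t) \<bullet> xpart (v t))"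

text \<open>Hofer-Zehnder capacity of a convex body: minimal positive action of closed characteristics.\<close>
definition c_HZ :: "(real^('n::finite + 'n)) set \<Rightarrow> real" where
  "c_HZ K = Inf {action T \<gamma> v | T \<gamma> v. closed_characteristic K T \<gamma> v \<and> 0 < action T \<gamma> v}"

definition Omega_Sigma :: "real^('n::finite + 'n)^('n + 'n) \<Rightarrow> (real^('n + 'n)) set" where
  "Omega_Sigma S = {z. (1/2) * (z \<bullet> (matrix_inv S *v z)) \<le> 1}"

end

theory Submission
  imports Defs
begin

text \<open>
  Let z = (x, p) be a closed characteristic of X \<times> P, with action A > 0. Almost everywhere x' is an
  outer normal of P at p and -p' one of X at x, so A is the integral of both support functions
  h_P(x') and h_X(-p'). As P contains the polar of X, the first expression bounds hbar times the
  length of the loop x in the norm with unit ball X. A loop of length l lies in a translate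
  c + (l / 4) X, hence (-p') \<bullet> (x - c) \<le> A / (4 hbar) h_X(-p'). Since p' integrates to 0,
  integrating this gives A \<le> A^2 / (4 hbar), that is, A \<ge> 4 hbar. The infimum is not the junk value
  of an empty set, because the two-bounce orbit through a maximiser of x \<bullet> p on X \<times> P is a closed
  characteristic.

  Testing the Hermitian form on u + i v gives hbar u \<bullet> J v \<le> u \<bullet> \<Sigma> u + v \<bullet> \<Sigma> v. This makes \<Sigma> positive
  definite, and with u = (p, 0), v = (0, s a) it shows that a hyperplane with normal a cannot
  separate a point p of the polar of X from P, whose support function at a is
  sqrt (2 (0, a) \<bullet> \<Sigma> (0, a)).
\<close>

section \<open>Integrating derivatives of Lipschitz maps that exist off a null set\<close>

text \<open>The exceptional null set of a closed characteristic may be uncountable, and then a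
  continuous function can have derivative zero off it without being constant. The Lipschitz bound
  excludes this.\<close>

lemma has_integral_lipschitz_derivative:
  fixes f :: "real \<Rightarrow> 'a::euclidean_space"
  assumes ab: "a \<le> b" and lip: "L-lipschitz_on {a..b} f" and N: "negligible N"
    and deriv: "\<And>t. t \<in> {a..b} - N \<Longrightarrow> (f has_vector_derivative f' t) (at t)"
  shows "(f' has_integral f b - f a) {a..b}"
proof -
  \<comment> \<open>Clamping the argument to [a, b] extends f to a Lipschitz map on the whole line,
    so that shifted points \<open>t + h k\<close> beyond b cause no trouble.\<close>
  define F where "F = (\<lambda>t. f (max a (min b t)))"
  have F_lip: "norm (F s - F t) \<le> L * \<bar>s - t\<bar>" for s t
  proof -
    have "dist (F s) (F t) \<le> L * dist (max a (min b s)) (max a (min b t))"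
      unfolding F_def using ab by (intro lipschitz_onD[OF lip]) auto
    also have "\<dots> \<le> L * dist s t"
      using lipschitz_on_nonneg[OF lip] by (intro mult_left_mono) (auto simp: dist_real_def)
    finally show ?thesis by (simp add: dist_norm)
  qed
  have F_cont: "continuous_on S F" for S
    by (rule lipschitz_on_continuous_on[of L], rule lipschitz_onI)
       (use F_lip lipschitz_on_nonneg[OF lip] in \<open>auto simp: dist_norm\<close>)
  \<comment> \<open>Starting at a - 1 makes every point of [a, b + 1], and so every shifted point,
    interior to [a - 1, b + 2], which turns one-sided derivatives of G into two-sided ones.\<close>
  define G where "G = (\<lambda>t. integral {a-1..t} F)"
  have G: "(G has_vector_derivative F t) (at t)" if "t \<in> {a..b+1}" for t
  proof -
    have "(G has_vector_derivative F t) (at t within {a-1..b+2})"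
      unfolding G_def using that by (intro integral_has_vector_derivative F_cont) auto
    moreover have "at t within {a-1..b+2} = at t"
      using that by (intro at_within_interior) auto
    ultimately show ?thesis by simp
  qed
  \<comment> \<open>The difference quotients of F are bounded by L and have the difference quotients of G as
    primitives, so dominated convergence gives the result.\<close>
  define h where "h = (\<lambda>k::nat. 1 / (1 + real k))"
  have h: "0 < h k" "h k \<le> 1" for k by (auto simp: h_def field_simps)
  have h_lim: "h \<longlonglongrightarrow> 0"
    unfolding h_def using LIMSEQ_inverse_real_of_nat by (simp add: field_simps)
  have quot_lim: "(\<lambda>k. (1 / h k) *\<^sub>R (H (t + h k) - H t)) \<longlonglongrightarrow> D"
    if "(H has_vector_derivative D) (at t)" for H :: "real \<Rightarrow> 'a" and D t
  proof -
    have "((\<lambda>s. norm (H (t + s) - H t - s *\<^sub>R D) / norm s) \<longlongrightarrow> 0) (at 0)"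
      using that by (simp add: has_vector_derivative_def has_derivative_at)
    moreover have "filterlim h (at 0) sequentially"
      using h_lim h(1) by (auto simp: filterlim_at less_imp_neq[symmetric])
    ultimately have "(\<lambda>k. norm (H (t + h k) - H t - h k *\<^sub>R D) / norm (h k)) \<longlonglongrightarrow> 0"
      by (rule filterlim_compose)
    moreover have "norm (H (t + h k) - H t - h k *\<^sub>R D) / norm (h k)
        = norm ((1 / h k) *\<^sub>R (H (t + h k) - H t) - D)" for k
    proof -
      have "(1 / h k) *\<^sub>R (H (t + h k) - H t) - D = (1 / h k) *\<^sub>R (H (t + h k) - H t - h k *\<^sub>R D)"
        using h(1)[of k] by (simp add: scaleR_diff_right)
      then show ?thesis using h(1)[of k] by simp
    qed
    ultimately show ?thesis
      by (simp only: LIM_zero_iff tendsto_norm_zero_iff)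
  qed
  \<comment> \<open>At a and b the extension F is constant on one side, so its derivative there need
    not be that of f.\<close>
  define M where "M = N \<union> {a, b}"
  have M: "negligible M" using N by (simp add: M_def negligible_Un)
  define q where "q = (\<lambda>k t. (1 / h k) *\<^sub>R (F (t + h k) - F t))"
  define Q where "Q = (\<lambda>k t. (1 / h k) *\<^sub>R (G (t + h k) - G t))"
  have q_int: "(q k has_integral Q k b - Q k a) {a..b}" for k
  proof (rule fundamental_theorem_of_calculus[OF ab])
    fix t assume t: "t \<in> {a..b}"
    have "((\<lambda>t. t + h k) has_vector_derivative 1) (at t)"
      by (auto intro!: derivative_eq_intros)
    moreover have "(G has_vector_derivative F (t + h k)) (at (t + h k))"
      using t h[of k] by (intro G) auto
    ultimately have 1: "((\<lambda>t. G (t + h k)) has_vector_derivative F (t + h k)) (at t)"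
      using vector_diff_chain_at[of "\<lambda>t. t + h k" 1 t G "F (t + h k)"] by (simp add: o_def)
    show "(Q k has_vector_derivative q k t) (at t within {a..b})"
      unfolding Q_def q_def using 1 G[of t] t
      by (auto intro!: derivative_eq_intros intro: has_vector_derivative_at_within)
  qed
  \<comment> \<open>Setting both functions to 0 on the null set gives convergence at every point of
    [a, b] and changes no integral.\<close>
  define q' where "q' = (\<lambda>k t. if t \<in> M then 0 else q k t)"
  define g' where "g' = (\<lambda>t. if t \<in> M then 0 else f' t)"
  have q'_int: "(q' k has_integral Q k b - Q k a) {a..b}" for k
    by (rule has_integral_spike[OF M _ q_int]) (auto simp: q'_def)
  have lim: "(\<lambda>k. q' k t) \<longlonglongrightarrow> g' t" if t: "t \<in> {a..b}" for t
  proof (cases "t \<in> M")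
    case False
    then have t': "a < t" "t < b" "t \<notin> N" using t by (auto simp: M_def)
    have "(F has_vector_derivative f' t) (at t)"
      by (rule has_vector_derivative_transform_within_open[OF deriv[of t], of "{a<..<b}"])
         (use t' in \<open>auto simp: F_def\<close>)
    then show ?thesis using False quot_lim by (simp add: q'_def g'_def q_def)
  qed (simp add: q'_def g'_def)
  have bnd: "norm (q' k t) \<le> L" if "t \<in> {a..b}" for k t
  proof -
    have "norm (q k t) = norm (F (t + h k) - F t) / h k" using h(1)[of k] by (simp add: q_def)
    also have "\<dots> \<le> L" using F_lip[of "t + h k" t] h(1)[of k] by (simp add: field_simps)
    finally show ?thesis using lipschitz_on_nonneg[OF lip] by (simp add: q'_def)
  qed
  note dc = dominated_convergence[of q' "{a..b}" "\<lambda>_. L" g', OF _ _ bnd lim]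
  have "g' integrable_on {a..b}" "(\<lambda>k. integral {a..b} (q' k)) \<longlonglongrightarrow> integral {a..b} g'"
    using q'_int by (auto intro!: dc)
  \<comment> \<open>The integrals of the quotients of F are differences of quotients of G at b and
    a, and these quotients tend to F b and F a.\<close>
  moreover have "(\<lambda>k. integral {a..b} (q' k)) \<longlonglongrightarrow> F b - F a"
    unfolding integral_unique[OF q'_int] Q_def using ab
    by (intro tendsto_diff quot_lim G) auto
  ultimately have "(g' has_integral F b - F a) {a..b}"
    by (metis LIMSEQ_unique has_integral_integral)
  then have "(f' has_integral F b - F a) {a..b}"
    by (rule has_integral_spike[OF M, rotated]) (auto simp: g'_def)
  then show ?thesis using ab by (simp add: F_def)
qed

lemma has_integral_le_negligible:
  fixes f g :: "'a::euclidean_space \<Rightarrow> real"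
  assumes "(f has_integral i) S" "(g has_integral j) S" "negligible N"
    and "\<And>x. x \<in> S - N \<Longrightarrow> f x \<le> g x"
  shows "i \<le> j"
proof (rule has_integral_le)
  show "((\<lambda>x. if x \<in> N then g x else f x) has_integral i) S"
    by (rule has_integral_spike[OF assms(3) _ assms(1)]) auto
qed (use assms in auto)

text \<open>Needed to integrate the product rule for p \<bullet> x along a closed
  characteristic.\<close>

lemma lipschitz_on_inner:
  fixes f g :: "'a::metric_space \<Rightarrow> 'b::real_inner"
  assumes f: "C-lipschitz_on S f" and g: "D-lipschitz_on S g"
    and bounds: "\<And>s. s \<in> S \<Longrightarrow> norm (f s) \<le> A" "\<And>s. s \<in> S \<Longrightarrow> norm (g s) \<le> B"
    and "0 \<le> A" "0 \<le> B"
  shows "(A * D + B * C)-lipschitz_on S (\<lambda>s. f s \<bullet> g s)"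
proof (rule lipschitz_onI)
  fix s t assume st: "s \<in> S" "t \<in> S"
  have "f s \<bullet> g s - f t \<bullet> g t = f s \<bullet> (g s - g t) + (f s - f t) \<bullet> g t"
    by (simp add: inner_diff_left inner_diff_right)
  also have "\<bar>\<dots>\<bar> \<le> norm (f s) * norm (g s - g t) + norm (f s - f t) * norm (g t)"
    by (intro order_trans[OF abs_triangle_ineq] add_mono Cauchy_Schwarz_ineq2)
  also have "\<dots> \<le> A * (D * dist s t) + (C * dist s t) * B"
    using st lipschitz_onD[OF f st] lipschitz_onD[OF g st] bounds assms(5,6)
      lipschitz_on_nonneg[OF f] lipschitz_on_nonneg[OF g]
    by (intro add_mono mult_mono) (auto simp: dist_norm)
  finally show "dist (f s \<bullet> g s) (f t \<bullet> g t) \<le> (A * D + B * C) * dist s t"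
    by (simp add: dist_real_def algebra_simps)
qed (use assms lipschitz_on_nonneg[OF f] lipschitz_on_nonneg[OF g] in auto)

section \<open>Splitting phase space into positions and momenta\<close>

definition join :: "real^'n::finite \<Rightarrow> real^'n \<Rightarrow> real^('n + 'n)" where
  "join x p = (\<chi> i. case i of Inl a \<Rightarrow> x $ a | Inr a \<Rightarrow> p $ a)"

lemma parts_join [simp]: "xpart (join x p) = x" "ppart (join x p) = p"
  by (simp_all add: join_def xpart_def ppart_def vec_eq_iff)

lemma parts_eqI: "xpart z = xpart w \<Longrightarrow> ppart z = ppart w \<Longrightarrow> z = w"
  by (auto simp: xpart_def ppart_def vec_eq_iff) (metis sumE)

lemma sum_UNIV_plus:
  "(\<Sum>i\<in>UNIV. f i) = (\<Sum>a\<in>UNIV. f (Inl a)) + (\<Sum>a\<in>UNIV. f (Inr a))"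
  for f :: "'a::finite + 'b::finite \<Rightarrow> 'c::comm_monoid_add"
  using sum.Plus[of UNIV UNIV f] by simp

lemma inner_parts: "z \<bullet> w = xpart z \<bullet> xpart w + ppart z \<bullet> ppart w"
  by (simp add: inner_vec_def xpart_def ppart_def sum_UNIV_plus)

lemma linear_parts: "linear xpart" "linear ppart"
  by (auto intro!: linearI simp: xpart_def ppart_def vec_eq_iff)

lemma bounded_linear_parts: "bounded_linear xpart" "bounded_linear ppart"
  using linear_parts by (auto simp: linear_conv_bounded_linear)

lemmas parts_simps [simp] =
  linear_0[OF linear_parts(1)] linear_0[OF linear_parts(2)]
  linear_add[OF linear_parts(1)] linear_add[OF linear_parts(2)]
  linear_diff[OF linear_parts(1)] linear_diff[OF linear_parts(2)]
  linear_neg[OF linear_parts(1)] linear_neg[OF linear_parts(2)]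
  linear_scale[OF linear_parts(1)] linear_scale[OF linear_parts(2)]

lemma norm_parts_le: "norm (xpart z) \<le> norm z" "norm (ppart z) \<le> norm z"
  by (simp_all add: norm_le inner_parts[of z])

lemma lipschitz_on_parts:
  fixes f :: "'a::metric_space \<Rightarrow> real^('n::finite + 'n)"
  assumes "L-lipschitz_on S f"
  shows "L-lipschitz_on S (\<lambda>t. xpart (f t))" "L-lipschitz_on S (\<lambda>t. ppart (f t))"
proof -
  have "dist (xpart z) (xpart w) \<le> dist z w" "dist (ppart z) (ppart w) \<le> dist z w"
    for z w :: "real^('n + 'n)"
    using norm_parts_le[of "z - w"] by (simp_all add: dist_norm)
  then show "L-lipschitz_on S (\<lambda>t. xpart (f t))" "L-lipschitz_on S (\<lambda>t. ppart (f t))"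
    using assms unfolding lipschitz_on_def by (meson order_trans)+
qed

lemma parts_Jmat:
  "xpart (Jmat *v w) = ppart w" "ppart (Jmat *v w) = - xpart w"
  by (simp_all add: vec_eq_iff xpart_def ppart_def matrix_vector_mult_def Jmat_def
      sum_UNIV_plus if_distrib[of "\<lambda>c. c * _"] sum.delta cong: if_cong)

text \<open>Keeping one component of the test point equal to that of z removes its share of the
  inner product.\<close>

lemma normal_cone_product:
  assumes w: "w \<in> normal_cone (phase_product X P) z" and z: "z \<in> phase_product X P"
  shows "xpart w \<in> normal_cone X (xpart z)" "ppart w \<in> normal_cone P (ppart z)"
proof -
  have "w \<bullet> (join x p - z) \<le> 0" if "x \<in> X" "p \<in> P" for x p
    using w that by (auto simp: normal_cone_def phase_product_def)
  from this[of _ "ppart z"] this[of "xpart z"] z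
  show "xpart w \<in> normal_cone X (xpart z)" "ppart w \<in> normal_cone P (ppart z)"
    by (auto simp: normal_cone_def phase_product_def inner_parts[of w])
qed

section \<open>Symmetric convex bodies and their products\<close>

lemma sym_convex_body_uminus: "sym_convex_body X \<Longrightarrow> x \<in> X \<Longrightarrow> - x \<in> X"
  by (auto simp: sym_convex_body_def)

lemma sym_convex_body_0_interior:
  assumes "sym_convex_body X" shows "0 \<in> interior X"
proof -
  obtain x where x: "x \<in> interior X" using assms by (auto simp: sym_convex_body_def)
  have "- x \<in> interior X"
    using x interior_negations[of X] assms by (force simp: sym_convex_body_def)
  moreover have "convex (interior X)"
    using assms by (auto simp: sym_convex_body_def convex_interior)
  ultimately have "(1/2) *\<^sub>R x + (1/2) *\<^sub>R (- x) \<in> interior X"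
    using x by (intro convexD) auto
  then show ?thesis by simp
qed

lemma compact_phase_product:
  fixes X P :: "(real^'n::finite) set"
  assumes "compact X" "compact P" shows "compact (phase_product X P)"
proof -
  have "z \<in> (\<lambda>(x, p). join x p) ` (X \<times> P)" if "z \<in> phase_product X P" for z
  proof
    show "z = (case (xpart z, ppart z) of (x, p) \<Rightarrow> join x p)"
      by (rule parts_eqI) simp_all
  qed (use that in \<open>simp add: phase_product_def\<close>)
  then have "phase_product X P = (\<lambda>(x, p). join x p) ` (X \<times> P)"
    by (auto simp: phase_product_def)
  moreover have "linear (\<lambda>(x, p). join x p :: real^('n + 'n))"
    by (rule linearI) (auto simp: join_def vec_eq_iff split: sum.split)
  ultimately show ?thesis
    using assms by (simp add: compact_Times compact_continuous_image linear_continuous_on linear_conv_bounded_linear)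
qed

section \<open>Lower bound for positive actions\<close>

lemma action_closed_characteristic_ge:
  assumes hbar: "0 < hbar" and pair: "hbar_polar_quantum_pair hbar X P"
    and char: "closed_characteristic (phase_product X P) T \<gamma> v"
    and pos: "0 < action T \<gamma> v"
  shows "4 * hbar \<le> action T \<gamma> v"
proof -
  note X = pair[unfolded hbar_polar_quantum_pair_def, THEN conjunct1]
    and P = pair[unfolded hbar_polar_quantum_pair_def, THEN conjunct2, THEN conjunct1]
  define x p where "x = (\<lambda>t. xpart (\<gamma> t))" and "p = (\<lambda>t. ppart (\<gamma> t))"
  define x' p' where "x' = (\<lambda>t. xpart (v t))" and "p' = (\<lambda>t. ppart (v t))"
  define A where "A = action T \<gamma> v"
  obtain L where T: "0 < T" and L: "L-lipschitz_on {0..T} \<gamma>" and loop: "\<gamma> 0 = \<gamma> T"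
    and front: "\<And>t. t \<in> {0..T} \<Longrightarrow> \<gamma> t \<in> frontier (phase_product X P)"
    using char unfolding closed_characteristic_def by blast
  obtain N where N: "negligible N"
    and deriv: "\<And>t. t \<in> {0..T} - N \<Longrightarrow> (\<gamma> has_vector_derivative v t) (at t)"
    and cone: "\<And>t. t \<in> {0..T} - N \<Longrightarrow>
      v t \<in> (\<lambda>w. Jmat *v w) ` normal_cone (phase_product X P) (\<gamma> t)"
    using char unfolding closed_characteristic_def negligible_iff_null_sets
    by (blast intro: null_sets_completionI)
  have compact: "compact X" "compact P" "compact (phase_product X P)"
    using X P by (auto simp: sym_convex_body_def intro: compact_phase_product)
  have \<gamma>_in: "\<gamma> t \<in> phase_product X P" if "t \<in> {0..T}" for t
    using front[OF that] compact_imp_closed[OF compact(3)] frontier_subset_closed by blast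
  have in_XP: "x t \<in> X" "p t \<in> P" if "t \<in> {0..T}" for t
    using \<gamma>_in[OF that] by (auto simp: x_def p_def phase_product_def)
  have zero: "0 \<in> X" using sym_convex_body_0_interior[OF X] interior_subset by blast
  have loop': "x T = x 0" "p T = p 0" using loop by (simp_all add: x_def p_def)
  have x_lip: "L-lipschitz_on {0..T} x" and p_lip: "L-lipschitz_on {0..T} p"
    using lipschitz_on_parts[OF L] by (simp_all add: x_def p_def)
  have x_deriv: "(x has_vector_derivative x' t) (at t)" if "t \<in> {0..T} - N" for t
    using deriv[OF that] bounded_linear_parts(1)
    by (auto simp: x_def x'_def intro: bounded_linear.has_vector_derivative)
  have p_deriv: "(p has_vector_derivative p' t) (at t)" if "t \<in> {0..T} - N" for t
    using deriv[OF that] bounded_linear_parts(2)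
    by (auto simp: p_def p'_def intro: bounded_linear.has_vector_derivative)
  \<comment> \<open>Since J w has the components w_p and - w_x, the vectors x' and - p' are the
    momentum and position parts of the normal w.\<close>
  have cones: "- p' t \<in> normal_cone X (x t)" "x' t \<in> normal_cone P (p t)"
    if t: "t \<in> {0..T} - N" for t
  proof -
    obtain w where "v t = Jmat *v w" "w \<in> normal_cone (phase_product X P) (\<gamma> t)"
      using cone[OF t] by blast
    then show "- p' t \<in> normal_cone X (x t)" "x' t \<in> normal_cone P (p t)"
      using normal_cone_product[of w X P "\<gamma> t"] \<gamma>_in[of t] t
      by (auto simp: parts_Jmat x_def p_def x'_def p'_def)
  qed
  have x'_cone: "x' t \<bullet> y \<le> x' t \<bullet> p t" if "t \<in> {0..T} - N" "y \<in> P" for t y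
    using cones(2)[OF that(1)] that(2) by (auto simp: normal_cone_def inner_diff_right)
  have p'_cone: "- p' t \<bullet> z \<le> - p' t \<bullet> x t" if "t \<in> {0..T} - N" "z \<in> X" for t z
    using cones(1)[OF that(1)] that(2) by (auto simp: normal_cone_def inner_diff_right)
  \<comment> \<open>A non-integrable function would have Henstock--Kurzweil integral 0.\<close>
  have A_int: "((\<lambda>t. p t \<bullet> x' t) has_integral A) {0..T}"
    using pos not_integrable_integral[of "\<lambda>t. p t \<bullet> x' t" "{0..T}"]
    by (force simp: A_def action_def p_def x'_def has_integral_integrable_integral)
  \<comment> \<open>\<Phi> takes the place of hbar times arc length: its integrand is the support
    function of P at x', which bounds y \<bullet> x' for every y in the polar of X.\<close>
  define \<Phi> where "\<Phi> = (\<lambda>t. integral {0..t} (\<lambda>t. p t \<bullet> x' t))"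
  have \<Phi>_ends: "\<Phi> 0 = 0" "\<Phi> T = A"
    using A_int by (auto simp: \<Phi>_def)
  have x_incr: "y \<bullet> (x t - x s) \<le> \<Phi> t - \<Phi> s"
    if y: "y \<in> hbar_polar hbar X" and st: "0 \<le> s" "s \<le> t" "t \<le> T" for y s t
  proof (rule has_integral_le_negligible[OF _ _ N])
    have "(x' has_integral x t - x s) {s..t}"
      using st by (intro has_integral_lipschitz_derivative[OF _ lipschitz_on_subset[OF x_lip] N] x_deriv) auto
    then show "((\<lambda>t. y \<bullet> x' t) has_integral y \<bullet> (x t - x s)) {s..t}"
      using has_integral_linear[OF _ bounded_linear_inner_right[of y], of x' "x t - x s" "{s..t}"]
      by (simp add: o_def)
    have "(\<lambda>t. p t \<bullet> x' t) integrable_on {0..t}" "(\<lambda>t. p t \<bullet> x' t) integrable_on {s..t}"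
      using has_integral_integrable[OF A_int] st by (auto intro: integrable_on_subinterval)
    moreover from this(1) have "\<Phi> t - \<Phi> s = integral {s..t} (\<lambda>t. p t \<bullet> x' t)"
      using Henstock_Kurzweil_Integration.integral_combine[of 0 s t "\<lambda>t. p t \<bullet> x' t"] st
      by (auto simp: \<Phi>_def)
    ultimately show "((\<lambda>t. p t \<bullet> x' t) has_integral \<Phi> t - \<Phi> s) {s..t}"
      by (simp add: has_integral_integrable_integral)
    have "y \<in> P" using y pair by (auto simp: hbar_polar_quantum_pair_def)
    then show "y \<bullet> x' r \<le> p r \<bullet> x' r" if "r \<in> {s..t} - N" for r
      using x'_cone[of r y] that st by (auto simp: inner_commute)
  qed
  \<comment> \<open>The loop x is cut into two arcs of equal length; every point of it then lies within a quarter
    of its length of the midpoint c of the two cutting points.\<close>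
  obtain \<tau> where \<tau>: "0 \<le> \<tau>" "\<tau> \<le> T" "\<Phi> \<tau> = A / 2"
  proof -
    have "continuous_on {0..T} \<Phi>"
      unfolding \<Phi>_def using A_int by (intro indefinite_integral_continuous_1) (auto simp: integrable_on_def)
    then show ?thesis
      using IVT'[of \<Phi> 0 "A / 2" T] that \<Phi>_ends T pos by (auto simp: A_def)
  qed
  define c where "c = (1/2) *\<^sub>R (x 0 + x \<tau>)"
  have centred: "y \<bullet> (x t - c) \<le> A / 4" if y: "y \<in> hbar_polar hbar X" and t: "t \<in> {0..T}" for y t
  proof -
    have y': "- y \<in> hbar_polar hbar X"
      using y sym_convex_body_uminus[OF X] by (force simp: hbar_polar_def)
    have "y \<bullet> (x t - x 0) + y \<bullet> (x t - x \<tau>) \<le> A / 2"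
    \<comment> \<open>The way from one cutting point to x t is estimated with y, the way on to the
      other with - y. Together they cost one arc, that is, A / 2; on the second arc x T = x 0 is
      used.\<close>
    proof (cases "t \<le> \<tau>")
      case True
      then show ?thesis
        using x_incr[OF y, of 0 t] x_incr[OF y', of t \<tau>] t \<tau> \<Phi>_ends
        by (auto simp: inner_diff_right)
    next
      case False
      then show ?thesis
        using x_incr[OF y, of \<tau> t] x_incr[OF y', of t T] t \<tau> \<Phi>_ends loop'
        by (auto simp: inner_diff_right)
    qed
    moreover have "y \<bullet> (x t - c) = (y \<bullet> (x t - x 0) + y \<bullet> (x t - x \<tau>)) / 2"
      by (simp add: c_def inner_diff_right inner_add_right field_simps)
    ultimately show ?thesis by simp
  qed
  \<comment> \<open>The case y parallel to - p' t of centred; e keeps the normalising factor h positive.\<close>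
  have p'_centred: "- p' t \<bullet> (x t - c) \<le> A / (4 * hbar) * (- p' t \<bullet> x t)" if t: "t \<in> {0..T} - N" for t
  proof (rule field_le_epsilon)
    fix e :: real assume "0 < e"
    define h where "h = - p' t \<bullet> x t + e * (4 * hbar) / A"
    have "0 \<le> - p' t \<bullet> x t" using p'_cone[OF t zero] by simp
    moreover have "0 < e * (4 * hbar) / A" using \<open>0 < e\<close> hbar pos by (simp add: A_def)
    ultimately have h: "- p' t \<bullet> x t < h" "0 < h" by (simp_all add: h_def)
    have "(hbar / h) *\<^sub>R (- p' t) \<in> hbar_polar hbar X"
    proof -
      have "- p' t \<bullet> z \<le> h" if "z \<in> X" for z
        using p'_cone[OF t that] h(1) by linarith
      then have "hbar / h * (- p' t \<bullet> z) \<le> hbar / h * h" if "z \<in> X" for z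
        using h hbar that by (intro mult_left_mono) auto
      then show ?thesis using h by (simp add: hbar_polar_def)
    qed
    from centred[OF this, of t] t have "(hbar / h) * (- p' t \<bullet> (x t - c)) \<le> A / 4" by simp
    then have "- p' t \<bullet> (x t - c) \<le> A / (4 * hbar) * h"
      using h hbar by (simp add: field_simps)
    also have "\<dots> = A / (4 * hbar) * (- p' t \<bullet> x t) + e"
      using hbar pos by (simp add: h_def A_def field_simps)
    finally show "- p' t \<bullet> (x t - c) \<le> A / (4 * hbar) * (- p' t \<bullet> x t) + e" .
  qed
  \<comment> \<open>p \<bullet> x agrees at both ends of the loop, so its derivative integrates to 0
    and the action is also the integral of - p' \<bullet> x.\<close>
  have "((\<lambda>t. p t \<bullet> x' t + p' t \<bullet> x t) has_integral p T \<bullet> x T - p 0 \<bullet> x 0) {0..T}"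
  proof -
    obtain R where R: "0 < R" "\<And>z. z \<in> X \<union> P \<Longrightarrow> norm z \<le> R"
      using compact by (meson bounded_pos bounded_Un compact_imp_bounded)
    show ?thesis
    proof (rule has_integral_lipschitz_derivative[OF _ _ N])
      show "(R * L + R * L)-lipschitz_on {0..T} (\<lambda>t. p t \<bullet> x t)"
        using R in_XP by (intro lipschitz_on_inner x_lip p_lip) auto
      show "((\<lambda>t. p t \<bullet> x t) has_vector_derivative p t \<bullet> x' t + p' t \<bullet> x t) (at t)"
        if "t \<in> {0..T} - N" for t
        using bounded_bilinear.has_vector_derivative[OF bounded_bilinear_inner p_deriv[OF that] x_deriv[OF that]] .
    qed (use T in auto)
  qed
  from has_integral_diff[OF A_int this] loop'
  have p'x_int: "((\<lambda>t. - p' t \<bullet> x t) has_integral A) {0..T}" by simp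
  have "(p' has_integral 0) {0..T}"
    using T has_integral_lipschitz_derivative[OF _ p_lip N p_deriv] loop' by simp
  then have "((\<lambda>t. p' t \<bullet> c) has_integral 0) {0..T}"
    using has_integral_linear[OF _ bounded_linear_inner_left[of c], of p' 0 "{0..T}"]
    by (simp add: o_def)
  from has_integral_add[OF p'x_int this]
  have "((\<lambda>t. - p' t \<bullet> (x t - c)) has_integral A) {0..T}"
    by (simp add: inner_diff_right)
  moreover have "((\<lambda>t. A / (4 * hbar) * (- p' t \<bullet> x t)) has_integral A / (4 * hbar) * A) {0..T}"
    by (intro has_integral_mult_right p'x_int)
  ultimately have "A \<le> A / (4 * hbar) * A"
    by (rule has_integral_le_negligible[OF _ _ N p'_centred])
  then show ?thesis
    using hbar pos by (simp add: A_def field_simps)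
qed

section \<open>A closed characteristic of positive action\<close>

text \<open>A small step from z along w would stay in K and increase the product with w. The
  two-bounce orbit is shown to stay on the boundary by exhibiting nonzero normals.\<close>

lemma interior_normal_cone:
  assumes "z \<in> interior K" "w \<in> normal_cone K z" shows "w = 0"
proof (rule ccontr)
  assume "w \<noteq> 0"
  obtain e where e: "0 < e" "ball z e \<subseteq> K" using assms(1) by (auto simp: mem_interior)
  define s where "s = e / (2 * norm w)"
  have s: "0 < s" using \<open>w \<noteq> 0\<close> e by (simp add: s_def)
  have "z + s *\<^sub>R w \<in> K"
    using e \<open>w \<noteq> 0\<close> by (intro subsetD[OF e(2)]) (auto simp: dist_norm s_def)
  then have "w \<bullet> (s *\<^sub>R w) \<le> 0" using assms(2) by (force simp: normal_cone_def)
  then show False using s \<open>w \<noteq> 0\<close> inner_gt_zero_iff[of w] by (simp add: mult_le_0_iff del: inner_gt_zero_iff)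
qed

lemma sym_convex_body_scaleR:
  assumes X: "sym_convex_body X" and "x \<in> X" "\<bar>a\<bar> \<le> 1" shows "a *\<^sub>R x \<in> X"
proof -
  have "((1 + a) / 2) *\<^sub>R x + ((1 - a) / 2) *\<^sub>R (- x) \<in> X"
    using assms sym_convex_body_uminus[OF X] by (intro convexD) (auto simp: sym_convex_body_def field_simps)
  moreover have "((1 + a) / 2) *\<^sub>R x + ((1 - a) / 2) *\<^sub>R (- x) = ((1 + a) / 2 - (1 - a) / 2) *\<^sub>R x"
    by (simp add: scaleR_diff_left)
  moreover have "(1 + a) / 2 - (1 - a) / 2 = a" by (simp add: field_simps)
  ultimately show ?thesis by simp
qed

text \<open>The two-bounce orbit: for a maximiser (q, p) of the pairing on X \<times> P, the vector p is normal
  to X at q and q is normal to P at p. So x may run between -q and q while p is constant, and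
  p between -p and p while x is constant.\<close>

lemma exists_closed_characteristic:
  fixes X P :: "(real^'n::finite) set"
  assumes X: "sym_convex_body X" and P: "sym_convex_body P"
  shows "\<exists>T \<gamma> v. closed_characteristic (phase_product X P) T \<gamma> v \<and> 0 < action T \<gamma> v"
proof -
  have compact: "compact X" "compact P" using X P by (auto simp: sym_convex_body_def)
  obtain r where r: "0 < r" "ball 0 r \<subseteq> X" "ball 0 r \<subseteq> P"
  proof -
    have "0 \<in> interior (X \<inter> P)" using X P by (simp add: sym_convex_body_0_interior)
    then show ?thesis using that unfolding mem_interior by blast
  qed
  obtain q p where qp: "q \<in> X" "p \<in> P" and max: "\<And>x y. x \<in> X \<Longrightarrow> y \<in> P \<Longrightarrow> x \<bullet> y \<le> q \<bullet> p"
  proof -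
    have "\<exists>z\<in>X \<times> P. \<forall>w\<in>X \<times> P. fst w \<bullet> snd w \<le> fst z \<bullet> snd z"
      using r compact by (intro continuous_attains_sup continuous_intros)
        (auto simp: compact_Times intro: centre_in_ball[THEN iffD2])
    then show ?thesis using that by fastforce
  qed
  define m where "m = q \<bullet> p"
  \<comment> \<open>A short nonzero vector lies in both bodies, and its product with itself is at
    most m.\<close>
  have m: "0 < m"
  proof -
    define e :: "real^'n" where "e = (r / 2) *\<^sub>R axis undefined 1"
    have "e \<in> ball 0 r" using r by (simp add: e_def norm_axis_1)
    then have "e \<bullet> e \<le> m" using r max unfolding m_def by blast
    moreover have "0 < e \<bullet> e" using r by (simp add: e_def axis_eq_0_iff)
    ultimately show ?thesis by linarith
  qed
  then have nz: "q \<noteq> 0" "p \<noteq> 0" by (auto simp: m_def)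
  have max_q: "\<bar>q \<bullet> y\<bar> \<le> m" if "y \<in> P" for y
    using max[OF qp(1) that] max[OF qp(1) sym_convex_body_uminus[OF P that]] by (auto simp: m_def)
  have max_p: "\<bar>p \<bullet> x\<bar> \<le> m" if "x \<in> X" for x
    using max[OF that qp(2)] max[OF sym_convex_body_uminus[OF X that] qp(2)] by (auto simp: m_def inner_commute)
  \<comment> \<open>On the four unit intervals of [0, 4], a rises from -1 to 1, rests at 1, falls to
    -1 and rests there, while b rests at 1, falls to -1, rests there and rises again. The orbit thus
    runs around a parallelogram side by side.\<close>
  define a b where "a = (\<lambda>t::real. max (-1) (min 1 (min (2*t-1) (5-2*t))))"
    and "b = (\<lambda>t::real. max (-1) (min 1 (max (3-2*t) (2*t-7))))"
  define a' b' where "a' = (\<lambda>t::real. if t < 1 then 2 else if t < 2 then 0 else if t < 3 then -2 else 0 :: real)"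
    and "b' = (\<lambda>t::real. if t < 1 then 0 else if t < 2 then -2 else if t < 3 then 0 else 2 :: real)"
  define \<gamma> v where "\<gamma> = (\<lambda>t. a t *\<^sub>R join q 0 + b t *\<^sub>R join 0 p)"
    and "v = (\<lambda>t. a' t *\<^sub>R join q 0 + b' t *\<^sub>R join 0 p)"
  define K where "K = phase_product X P"
  define N :: "real set" where "N = {0, 1, 2, 3, 4}"
  have parts: "xpart (\<gamma> t) = a t *\<^sub>R q" "ppart (\<gamma> t) = b t *\<^sub>R p"
    "xpart (v t) = a' t *\<^sub>R q" "ppart (v t) = b' t *\<^sub>R p" for t
    by (simp_all add: \<gamma>_def v_def)
  \<comment> \<open>The sign conditions say that a nonzero coefficient meets a coordinate at the end
    of its range, 1 or -1 according to its sign; there the bounds \<open>max_p\<close> and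
    \<open>max_q\<close> are attained.\<close>
  have cone: "join (\<alpha> *\<^sub>R p) (\<beta> *\<^sub>R q) \<in> normal_cone K (\<gamma> t)"
    if signs: "\<alpha> * a t = \<bar>\<alpha>\<bar>" "\<beta> * b t = \<bar>\<beta>\<bar>" for \<alpha> \<beta> t
  proof -
    have "join (\<alpha> *\<^sub>R p) (\<beta> *\<^sub>R q) \<bullet> (y - \<gamma> t) \<le> 0" if y: "y \<in> K" for y
    proof -
      have le: "d * e \<le> \<bar>d\<bar> * m" if "\<bar>e\<bar> \<le> m" for d e
        using that by (metis abs_ge_self abs_ge_zero abs_mult mult_left_mono order_trans)
      have "xpart y \<in> X" "ppart y \<in> P" using y by (simp_all add: K_def phase_product_def)
      then have "\<alpha> * (p \<bullet> xpart y) \<le> \<bar>\<alpha>\<bar> * m" "\<beta> * (q \<bullet> ppart y) \<le> \<bar>\<beta>\<bar> * m"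
        by (auto intro: le max_p max_q)
      moreover have "join (\<alpha> *\<^sub>R p) (\<beta> *\<^sub>R q) \<bullet> (y - \<gamma> t)
          = \<alpha> * (p \<bullet> xpart y - a t * m) + \<beta> * (q \<bullet> ppart y - b t * m)"
        by (simp add: inner_parts[of "join (\<alpha> *\<^sub>R p) (\<beta> *\<^sub>R q)"] parts m_def inner_diff_right inner_commute[of p q])
           (simp add: algebra_simps)
      ultimately show ?thesis
        using signs by (simp add: right_diff_distrib flip: mult.assoc)
    qed
    then show ?thesis by (simp add: normal_cone_def)
  qed
  have frontier: "\<gamma> t \<in> frontier K" if t: "t \<in> {0..4}" for t
  proof -
    have "\<bar>a t\<bar> \<le> 1" "\<bar>b t\<bar> \<le> 1" by (auto simp: a_def b_def)
    then have "\<gamma> t \<in> K"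
      using sym_convex_body_scaleR[OF X qp(1)] sym_convex_body_scaleR[OF P qp(2)]
      by (simp add: K_def phase_product_def parts)
    moreover have "\<gamma> t \<notin> interior K"
    proof
      assume int: "\<gamma> t \<in> interior K"
      \<comment> \<open>At every time one of the two coordinates rests at an end of its range and
        supplies a nonzero normal.\<close>
      consider "t \<le> 1" | "1 \<le> t" "t \<le> 2" | "2 \<le> t" "t \<le> 3" | "3 \<le> t" by linarith
      then have "\<bar>a t\<bar> = 1 \<or> \<bar>b t\<bar> = 1"
        by cases (simp_all add: a_def b_def)
      then show False
      proof
        assume "\<bar>a t\<bar> = 1"
        then have "join (a t *\<^sub>R p) (0 *\<^sub>R q) \<in> normal_cone K (\<gamma> t)"
          by (intro cone) (auto simp flip: power2_eq_square simp: abs_square_eq_1)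
        from interior_normal_cone[OF int this] have "xpart (join (a t *\<^sub>R p) (0 *\<^sub>R q)) = xpart 0" by simp
        then show False using \<open>\<bar>a t\<bar> = 1\<close> nz by auto
      next
        assume "\<bar>b t\<bar> = 1"
        then have "join (0 *\<^sub>R p) (b t *\<^sub>R q) \<in> normal_cone K (\<gamma> t)"
          by (intro cone) (auto simp flip: power2_eq_square simp: abs_square_eq_1)
        from interior_normal_cone[OF int this] have "ppart (join (0 *\<^sub>R p) (b t *\<^sub>R q)) = ppart 0" by simp
        then show False using \<open>\<bar>b t\<bar> = 1\<close> nz by auto
      qed
    qed
    ultimately show ?thesis using closure_subset[of K] by (auto simp: frontier_def)
  qed
  have intervals: "0 < t \<and> t < 1 \<or> 1 < t \<and> t < 2 \<or> 2 < t \<and> t < 3 \<or> 3 < t \<and> t < 4"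
    if "t \<in> {0..4} - N" for t
    using that by (auto simp: N_def)
  have piece: "(f has_real_derivative D) (at t)"
    if "l < t" "t < u" "\<And>s. l < s \<Longrightarrow> s < u \<Longrightarrow> f s = c + D * s" for f :: "real \<Rightarrow> real" and c D l u t
  proof (rule has_field_derivative_transform_within_open)
    show "((\<lambda>s. c + D * s) has_real_derivative D) (at t)" by (auto intro!: derivative_eq_intros)
    show "open {l<..<u}" "t \<in> {l<..<u}" using that by auto
  qed (use that in auto)
  have a_deriv: "(a has_real_derivative a' t) (at t)" if "t \<in> {0..4} - N" for t
    using intervals[OF that]
  proof (elim disjE conjE)
    assume "0 < t" "t < 1" then show ?thesis by (intro piece[of 0 t 1 _ "-1"]) (auto simp: a_def a'_def)
  next
    assume "1 < t" "t < 2" then show ?thesis by (intro piece[of 1 t 2 _ "1"]) (auto simp: a_def a'_def)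
  next
    assume "2 < t" "t < 3" then show ?thesis by (intro piece[of 2 t 3 _ "5"]) (auto simp: a_def a'_def)
  next
    assume "3 < t" "t < 4" then show ?thesis by (intro piece[of 3 t 4 _ "-1"]) (auto simp: a_def a'_def)
  qed
  have b_deriv: "(b has_real_derivative b' t) (at t)" if "t \<in> {0..4} - N" for t
    using intervals[OF that]
  proof (elim disjE conjE)
    assume "0 < t" "t < 1" then show ?thesis by (intro piece[of 0 t 1 _ "1"]) (auto simp: b_def b'_def)
  next
    assume "1 < t" "t < 2" then show ?thesis by (intro piece[of 1 t 2 _ "3"]) (auto simp: b_def b'_def)
  next
    assume "2 < t" "t < 3" then show ?thesis by (intro piece[of 2 t 3 _ "-1"]) (auto simp: b_def b'_def)
  next
    assume "3 < t" "t < 4" then show ?thesis by (intro piece[of 3 t 4 _ "-7"]) (auto simp: b_def b'_def)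
  qed
  have max_lip: "\<bar>max x y - max x' y'\<bar> \<le> d" and min_lip: "\<bar>min x y - min x' y'\<bar> \<le> d"
    if "\<bar>x - x'\<bar> \<le> d" "\<bar>y - y'\<bar> \<le> d" for x x' y y' d :: real
    using that by (auto simp: max_def min_def)
  have "(2 * norm (join q 0) + 2 * norm (join 0 p))-lipschitz_on {0..4} \<gamma>"
  proof (rule lipschitz_onI)
    fix s t :: real
    have "\<bar>a s - a t\<bar> \<le> 2 * \<bar>s - t\<bar>"
      unfolding a_def by (intro max_lip min_lip) (auto simp: abs_if)
    moreover have "\<bar>b s - b t\<bar> \<le> 2 * \<bar>s - t\<bar>"
      unfolding b_def by (intro max_lip min_lip) (auto simp: abs_if)
    ultimately have "norm ((a s - a t) *\<^sub>R join q 0 + (b s - b t) *\<^sub>R join 0 p)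
        \<le> 2 * \<bar>s - t\<bar> * norm (join q 0) + 2 * \<bar>s - t\<bar> * norm (join 0 p)"
      by (intro order_trans[OF norm_triangle_ineq] add_mono) (auto intro: mult_right_mono)
    then show "dist (\<gamma> s) (\<gamma> t) \<le> (2 * norm (join q 0) + 2 * norm (join 0 p)) * dist s t"
      by (simp add: dist_norm \<gamma>_def algebra_simps)
  qed auto
  moreover have "\<gamma> 0 = \<gamma> 4" by (simp add: \<gamma>_def a_def b_def)
  moreover have "\<gamma> 1 \<noteq> \<gamma> 0"
  proof
    assume "\<gamma> 1 = \<gamma> 0"
    then have "xpart (\<gamma> 1) = xpart (\<gamma> 0)" by simp
    then show False using nz by (simp add: parts a_def eq_neg_iff_add_eq_0 flip: scaleR_2)
  qed
  moreover have "N \<in> null_sets lborel"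
    by (intro finite_imp_null_set_lborel) (simp add: N_def)
  moreover have "(\<gamma> has_vector_derivative v t) (at t)" if "t \<in> {0..4} - N" for t
    unfolding \<gamma>_def v_def using a_deriv[OF that] b_deriv[OF that]
    by (auto intro!: derivative_eq_intros)
  moreover have "v t \<in> (\<lambda>w. Jmat *v w) ` normal_cone K (\<gamma> t)" if "t \<in> {0..4} - N" for t
  proof
    \<comment> \<open>This is the preimage of v under J. The sign conditions hold because b equals
      the sign of a' while x moves, and a equals the sign of - b' while p moves.\<close>
    show "join ((- b' t) *\<^sub>R p) (a' t *\<^sub>R q) \<in> normal_cone K (\<gamma> t)"
      using intervals[OF that] by (intro cone) (auto simp: a_def a'_def b_def b'_def)
    show "v t = Jmat *v join ((- b' t) *\<^sub>R p) (a' t *\<^sub>R q)"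
      by (rule parts_eqI) (simp_all add: parts parts_Jmat)
  qed
  ultimately have "closed_characteristic K 4 \<gamma> v"
    unfolding closed_characteristic_def using frontier
    by (intro conjI exI[of _ N] ballI bexI[of _ 1] exI[of _ "2 * norm (join q 0) + 2 * norm (join 0 p)"]) auto
  moreover have "action 4 \<gamma> v = 4 * m"
  proof -
    \<comment> \<open>The integrand is 2 m on the first and third unit intervals, where x moves, and
      0 on the other two; H accumulates it.\<close>
    define H where "H = (\<lambda>t::real. (min 2 (2 * t) + max 0 (min 2 (2 * t - 4))) * m)"
    have "((\<lambda>t. (b t * a' t) * m) has_integral H 4 - H 0) {0..4}"
    proof (rule fundamental_theorem_of_calculus_interior_strong[of N])
      show "(H has_vector_derivative b t * a' t * m) (at t)" if "t \<in> {0<..<4} - N" for t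
      proof -
        have t: "0 < t \<and> t < 1 \<or> 1 < t \<and> t < 2 \<or> 2 < t \<and> t < 3 \<or> 3 < t \<and> t < 4"
          using that by (intro intervals) auto
        have "((\<lambda>t. min 2 (2 * t) + max 0 (min 2 (2 * t - 4))) has_real_derivative b t * a' t) (at t)"
          using t
        proof (elim disjE)
          assume "0 < t \<and> t < 1"
          then show ?thesis by (intro piece[of 0 t 1 _ 0]) (auto simp: b_def a'_def)
        next
          assume "1 < t \<and> t < 2"
          then show ?thesis by (intro piece[of 1 t 2 _ 2]) (auto simp: a'_def)
        next
          assume "2 < t \<and> t < 3"
          then show ?thesis by (intro piece[of 2 t 3 _ "-2"]) (auto simp: b_def a'_def)
        next
          assume "3 < t \<and> t < 4"
          then show ?thesis by (intro piece[of 3 t 4 _ 4]) (auto simp: a'_def)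
        qed
        from DERIV_cmult_right[OF this, of m] show ?thesis
          by (simp add: H_def has_real_derivative_iff_has_vector_derivative mult.commute)
      qed
      show "continuous_on {0..4} H" unfolding H_def by (intro continuous_intros)
    qed (auto simp: N_def)
    then show ?thesis
      by (simp add: action_def parts m_def inner_commute mult.assoc integral_unique H_def)
  qed
  ultimately show ?thesis using m unfolding K_def by (metis mult_pos_pos zero_less_numeral)
qed

section \<open>From actions to the capacity\<close>

lemma hbar_polar_quantum_pair_c_HZ:
  assumes "0 < hbar" "hbar_polar_quantum_pair hbar X P"
  shows "4 * hbar \<le> c_HZ (phase_product X P)"
  unfolding c_HZ_def
proof (rule cInf_greatest)
  show "{action T \<gamma> v | T \<gamma> v. closed_characteristic (phase_product X P) T \<gamma> v \<and> 0 < action T \<gamma> v} \<noteq> {}"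
    using exists_closed_characteristic[of X P] assms by (auto simp: hbar_polar_quantum_pair_def)
qed (use action_closed_characteristic_ge[OF assms] in blast)

section \<open>The covariance ellipsoid and its support function\<close>

text \<open>Surjective linear maps are open, so the interior stays nonempty. This serves both for
  the ellipsoid as an image under \<Sigma> and for its two projections.\<close>

lemma sym_convex_body_linear_image:
  fixes f :: "'a::euclidean_space \<Rightarrow> 'b::euclidean_space"
  assumes X: "sym_convex_body X" and f: "linear f" "surj f"
  shows "sym_convex_body (f ` X)"
  unfolding sym_convex_body_def
proof (intro conjI)
  show "interior (f ` X) \<noteq> {}"
  proof -
    have "f ` interior X \<subseteq> interior (f ` X)"
      by (intro interior_maximal open_surjective_linear_image f image_mono interior_subset open_interior)
    then show ?thesis using X by (auto simp: sym_convex_body_def)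
  qed
  have "uminus ` f ` X = f ` uminus ` X" by (simp add: image_image linear_neg[OF f(1)])
  then show "uminus ` f ` X = f ` X" using X by (simp add: sym_convex_body_def)
qed (use X f in \<open>auto simp: sym_convex_body_def convex_linear_image linear_conv_bounded_linear
      intro: compact_continuous_image linear_continuous_on\<close>)

lemma inner_matrix_vector: "u \<bullet> (A *v v) = (\<Sum>i\<in>UNIV. \<Sum>j\<in>UNIV. u $ i * A $ i $ j * v $ j)"
  for A :: "real^'n^'m"
  by (simp add: inner_vec_def matrix_vector_mult_def sum_distrib_left mult.assoc)

lemma inner_Jmat: "u \<bullet> (Jmat *v v) = xpart u \<bullet> ppart v - ppart u \<bullet> xpart v"
  by (simp add: inner_parts[of u] parts_Jmat)

text \<open>In the form at u + i v the mixed terms of S are imaginary, whereas those of i J are real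
  and survive in the real part.\<close>

lemma hermitian_psd_symplectic_inequality:
  fixes S :: "real^('n::finite + 'n)^('n + 'n)"
  assumes "hermitian_psd (\<chi> i j. complex_of_real (S $ i $ j)
                            + \<i> * complex_of_real (hbar / 2) * complex_of_real (Jmat $ i $ j))"
  shows "hbar * (u \<bullet> (Jmat *v v)) \<le> u \<bullet> (S *v u) + v \<bullet> (S *v v)"
proof -
  define w :: "complex^('n + 'n)" where "w = (\<chi> i. Complex (u $ i) (v $ i))"
  let ?M = "\<lambda>i j. complex_of_real (S $ i $ j) + \<i> * complex_of_real (hbar / 2) * complex_of_real (Jmat $ i $ j)"
  have "0 \<le> Re (\<Sum>i\<in>UNIV. \<Sum>j\<in>UNIV. cnj (w $ i) * ?M i j * w $ j)"
    using assms[unfolded hermitian_psd_def, THEN conjunct2, THEN spec, of w, THEN conjunct2]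
    by (simp only: vec_lambda_beta)
  also have "\<dots> = (\<Sum>i\<in>UNIV. \<Sum>j\<in>UNIV. u $ i * S $ i $ j * u $ j + v $ i * S $ i $ j * v $ j
      - hbar / 2 * (u $ i * Jmat $ i $ j * v $ j) + hbar / 2 * (v $ i * Jmat $ i $ j * u $ j))"
    unfolding Re_sum by (intro sum.cong refl) (simp add: w_def field_simps)
  also have "\<dots> = u \<bullet> (S *v u) + v \<bullet> (S *v v)
      - hbar / 2 * (u \<bullet> (Jmat *v v)) + hbar / 2 * (v \<bullet> (Jmat *v u))"
    by (simp only: inner_matrix_vector sum.distrib sum_subtractf sum_distrib_left)
  \<comment> \<open>J is skew, so the two terms with factor hbar / 2 add up.\<close>
  also have "v \<bullet> (Jmat *v u) = - (u \<bullet> (Jmat *v v))"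
    by (simp add: inner_Jmat inner_commute)
  finally show ?thesis by simp
qed

text \<open>With v = - s J u the left side is hbar s (u \<bullet> u), while v \<bullet> S v is at
  most K s^2 (u \<bullet> u). The difference hbar s - K s^2 is largest at s = hbar / (2 K), with
  value hbar^2 / (4 K).\<close>

lemma coercive_of_symplectic_inequality:
  fixes S :: "real^('n::finite + 'n)^('n + 'n)"
  assumes hbar: "0 < hbar"
    and ineq: "\<And>u v. hbar * (u \<bullet> (Jmat *v v)) \<le> u \<bullet> (S *v u) + v \<bullet> (S *v v)"
  obtains k where "0 < k" "\<And>u. k * (u \<bullet> u) \<le> u \<bullet> (S *v u)"
proof -
  obtain K where K: "0 < K" "\<And>u. norm (S *v u) \<le> norm u * K"
    using bounded_linear.pos_bounded[OF matrix_vector_mul_bounded_linear[of S]] by blast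
  have upper: "u \<bullet> (S *v u) \<le> K * (u \<bullet> u)" for u
  proof -
    have "u \<bullet> (S *v u) \<le> norm u * norm (S *v u)" by (rule norm_cauchy_schwarz)
    also have "\<dots> \<le> norm u * (norm u * K)" using K by (intro mult_left_mono) auto
    finally show ?thesis by (simp add: dot_square_norm power2_eq_square mult_ac)
  qed
  have "hbar\<^sup>2 / (4 * K) * (u \<bullet> u) \<le> u \<bullet> (S *v u)" for u
  proof -
    define s where "s = hbar / (2 * K)"
    define v where "v = - (s *\<^sub>R (Jmat *v u))"
    have v_parts: "xpart v = - (s *\<^sub>R ppart u)" "ppart v = s *\<^sub>R xpart u"
      by (simp_all add: v_def parts_Jmat)
    have "u \<bullet> (Jmat *v v) = s * (u \<bullet> u)" "v \<bullet> v = s\<^sup>2 * (u \<bullet> u)"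
      by (simp_all add: inner_Jmat v_parts inner_parts[of u u] inner_parts[of v v] power2_eq_square algebra_simps)
    with ineq[of u v] upper[of v] have "hbar * (s * (u \<bullet> u)) \<le> u \<bullet> (S *v u) + K * (s\<^sup>2 * (u \<bullet> u))"
      by simp
    then show ?thesis
      using K(1) by (simp add: s_def power2_eq_square field_simps)
  qed
  then show ?thesis using that[of "hbar\<^sup>2 / (4 * K)"] hbar K by simp
qed

lemma sym_convex_body_quadratic:
  fixes S :: "real^'n::finite^'n"
  assumes k: "0 < k" "\<And>u. k * (u \<bullet> u) \<le> u \<bullet> (S *v u)"
  shows "sym_convex_body {u. u \<bullet> (S *v u) \<le> 2}" (is "sym_convex_body ?E")
  unfolding sym_convex_body_def
proof (intro conjI)
  have psd: "0 \<le> u \<bullet> (S *v u)" for u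
    using k(1) k(2)[of u] by (meson inner_ge_zero less_imp_le mult_nonneg_nonneg order_trans)
  have cont: "continuous_on UNIV (\<lambda>u. u \<bullet> (S *v u))"
    by (intro continuous_intros linear_continuous_on) simp
  have "bounded ?E"
  proof (rule boundedI)
    fix u assume "u \<in> ?E"
    then have "k * (u \<bullet> u) \<le> 2" using k(2)[of u] by simp
    then have "(norm u)\<^sup>2 \<le> 2 / k" using k(1) by (simp add: dot_square_norm field_simps)
    then show "norm u \<le> sqrt (2 / k)" by (rule real_le_rsqrt)
  qed
  moreover have "closed ?E" by (intro closed_Collect_le cont continuous_intros)
  ultimately show "compact ?E" by (simp add: compact_eq_bounded_closed)
  show "convex ?E"
  proof (rule convexI, clarsimp)
    fix u v and s t :: real
    assume uv: "u \<bullet> (S *v u) \<le> 2" "v \<bullet> (S *v v) \<le> 2" and st: "0 \<le> s" "0 \<le> t" "s + t = 1"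
    \<comment> \<open>The form at u - v cancels all mixed terms; as it is nonnegative, dropping it
      gives convexity.\<close>
    have "(s *\<^sub>R u + t *\<^sub>R v) \<bullet> (S *v (s *\<^sub>R u + t *\<^sub>R v)) + s * t * ((u - v) \<bullet> (S *v (u - v)))
        = (s + t) * (s * (u \<bullet> (S *v u)) + t * (v \<bullet> (S *v v)))"
      by (simp add: matrix_vector_right_distrib matrix_vector_mult_diff_distrib
          matrix_vector_mult_scaleR inner_simps algebra_simps)
    also have "\<dots> \<le> s * 2 + t * 2" using uv st by (auto intro!: add_mono mult_left_mono)
    finally show "(s *\<^sub>R u + t *\<^sub>R v) \<bullet> (S *v (s *\<^sub>R u + t *\<^sub>R v)) \<le> 2"
      using psd[of "u - v"] st by (smt (verit) mult_nonneg_nonneg)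
  qed
  have "open {u. u \<bullet> (S *v u) < 2}" by (intro open_Collect_less cont continuous_intros)
  then have "0 \<in> interior ?E" by (intro interiorI[of "{u. u \<bullet> (S *v u) < 2}"]) auto
  then show "interior ?E \<noteq> {}" by blast
  have neg: "- u \<in> ?E" if "u \<in> ?E" for u
    using that by (simp add: vec.neg)
  show "uminus ` ?E = ?E"
  proof
    show "?E \<subseteq> uminus ` ?E"
    proof
      fix u assume "u \<in> ?E" then show "u \<in> uminus ` ?E" by (intro image_eqI[of _ _ "- u"] neg) auto
    qed
  qed (use neg in blast)
qed

text \<open>The substitution z = S u replaces the inverse matrix by S, so that support functions of
  the ellipsoid can be read off from S.\<close>

lemma Omega_Sigma_eq:
  assumes inv: "invertible S"
  shows "Omega_Sigma S = (\<lambda>u. S *v u) ` {u. u \<bullet> (S *v u) \<le> 2}"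
proof -
  have S_inv: "S *v (matrix_inv S *v z) = z" "matrix_inv S *v (S *v z) = z" for z
    using someI_ex[OF inv[unfolded invertible_def]]
    by (simp_all add: matrix_vector_mul_assoc matrix_inv_def)
  show ?thesis
  proof (intro set_eqI iffI)
    fix z assume "z \<in> Omega_Sigma S"
    then show "z \<in> (\<lambda>u. S *v u) ` {u. u \<bullet> (S *v u) \<le> 2}"
      by (intro image_eqI[of _ _ "matrix_inv S *v z"]) (auto simp: Omega_Sigma_def S_inv inner_commute)
  qed (auto simp: Omega_Sigma_def S_inv inner_commute)
qed

text \<open>The support function of the ellipsoid at u is sqrt (2 d) with d = u \<bullet> S u. For d
  > 0 one test point suffices: the multiple k u on the boundary, where k = sqrt (2 / d).\<close>

lemma quadratic_le_of_support_le:
  fixes S :: "real^'n::finite^'n"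
  assumes le: "\<And>y. y \<bullet> (S *v y) \<le> 2 \<Longrightarrow> u \<bullet> (S *v y) \<le> \<beta>"
  shows "2 * (u \<bullet> (S *v u)) \<le> \<beta>\<^sup>2"
proof (cases "0 < u \<bullet> (S *v u)")
  case True
  define d where "d = u \<bullet> (S *v u)"
  define k where "k = sqrt (2 / d)"
  have k: "0 < k" "k * k * d = 2" using True by (simp_all add: k_def d_def)
  have "u \<bullet> (S *v (k *\<^sub>R u)) \<le> \<beta>"
    using k by (intro le) (simp add: matrix_vector_mult_scaleR d_def mult.assoc)
  then have "k * d \<le> \<beta>" by (simp add: matrix_vector_mult_scaleR d_def)
  then have "(k * d)\<^sup>2 \<le> \<beta>\<^sup>2" using k True by (intro power_mono) (auto simp: d_def)
  moreover have "(k * d)\<^sup>2 = (k * k * d) * d" by (simp add: power2_eq_square)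
  ultimately show ?thesis using k by (simp add: d_def)
next
  case False
  then show ?thesis by (smt (verit) zero_le_power2)
qed

theorem theorem2:
  fixes hbar :: real and Sigma :: "real^('n::finite + 'n)^('n + 'n)"
  assumes "0 < hbar"
    and "transpose Sigma = Sigma"
    and "hermitian_psd (\<chi> i j. complex_of_real (Sigma $ i $ j)
                                + \<i> * complex_of_real (hbar / 2) * complex_of_real (Jmat $ i $ j))"
  defines "X \<equiv> xpart ` Omega_Sigma Sigma"
    and "P \<equiv> ppart ` Omega_Sigma Sigma"
  shows "hbar_polar_quantum_pair hbar X P \<and> c_HZ (phase_product X P) \<ge> 4 * hbar"
proof -
  note hbar = assms(1)
  note ineq = hermitian_psd_symplectic_inequality[OF assms(3)]
  obtain k where k: "0 < k" "\<And>u. k * (u \<bullet> u) \<le> u \<bullet> (Sigma *v u)"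
    using coercive_of_symplectic_inequality[OF hbar ineq] by blast
  have pos: "0 < u \<bullet> (Sigma *v u)" if "u \<noteq> 0" for u
  proof -
    have "0 < k * (u \<bullet> u)" using k(1) that by simp
    then show ?thesis using k(2)[of u] by simp
  qed
  then have "\<forall>u. Sigma *v u = 0 \<longrightarrow> u = 0" by (metis inner_zero_right less_irrefl)
  then have inv: "invertible Sigma"
    by (simp add: invertible_left_inverse matrix_left_invertible_ker)
  define E where "E = {u. u \<bullet> (Sigma *v u) \<le> 2}"
  have E: "sym_convex_body E" unfolding E_def by (rule sym_convex_body_quadratic[OF k])
  have Omega: "Omega_Sigma Sigma = (\<lambda>u. Sigma *v u) ` E"
    unfolding E_def by (rule Omega_Sigma_eq[OF inv])
  have "surj (\<lambda>u. Sigma *v u)"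
    using inv by (simp add: invertible_right_inverse matrix_right_invertible_surjective)
  then have "sym_convex_body (Omega_Sigma Sigma)"
    unfolding Omega using E by (intro sym_convex_body_linear_image) auto
  moreover have "surj (xpart :: real^('n + 'n) \<Rightarrow> _)"
    by (rule surjI[of _ "\<lambda>x. join x 0"]) simp
  moreover have "surj (ppart :: real^('n + 'n) \<Rightarrow> _)"
    by (rule surjI[of _ "join 0"]) simp
  ultimately have X: "sym_convex_body X" and P: "sym_convex_body P"
    unfolding X_def P_def using linear_parts by (auto intro: sym_convex_body_linear_image)
  have "p \<in> P" if p: "p \<in> hbar_polar hbar X" for p
  proof (rule ccontr)
    assume "p \<notin> P"
    then obtain a b where ab: "a \<bullet> p < b" "\<And>y. y \<in> P \<Longrightarrow> b < a \<bullet> y"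
      using separating_hyperplane_closed_point[of P p] P compact_imp_closed[of P]
      unfolding sym_convex_body_def by blast
    \<comment> \<open>The normal is reversed so that the separation becomes an upper bound - b for
      the support function of the ellipsoid at U.\<close>
    define U where "U = join 0 (- a)"
    define W where "W = join p 0"
    have "U \<bullet> (Sigma *v y) \<le> - b" if "y \<bullet> (Sigma *v y) \<le> 2" for y
      using ab(2)[of "ppart (Sigma *v y)"] that
      by (auto simp: P_def Omega E_def U_def inner_parts[of "join _ _"])
    then have U: "2 * (U \<bullet> (Sigma *v U)) \<le> b\<^sup>2"
      using quadratic_le_of_support_le[of Sigma U "- b"] by simp
    have "W \<bullet> (Sigma *v y) \<le> hbar" if "y \<bullet> (Sigma *v y) \<le> 2" for y
      using p that by (auto simp: hbar_polar_def X_def Omega E_def W_def inner_parts[of "join _ _"])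
    then have W: "2 * (W \<bullet> (Sigma *v W)) \<le> hbar\<^sup>2"
      by (rule quadratic_le_of_support_le)
    \<comment> \<open>0 lies in P; the sign of b then permits squaring - b < \<alpha>.\<close>
    have "b < 0" using ab(2)[of 0] sym_convex_body_0_interior[OF P] interior_subset[of P] by auto
    define \<alpha> where "\<alpha> = - (a \<bullet> p)"
    have \<alpha>: "0 < \<alpha>" "b\<^sup>2 < \<alpha>\<^sup>2"
      using ab(1) \<open>b < 0\<close> power_strict_mono[of "- b" \<alpha> 2] by (auto simp: \<alpha>_def)
    \<comment> \<open>This s makes W \<bullet> J (s U) equal to hbar. The symplectic inequality then
      bounds hbar^2 by W \<bullet> \<Sigma> W + s^2 (U \<bullet> \<Sigma> U), whose first term is at
      most hbar^2 / 2 and whose second is below s^2 \<alpha>^2 / 2 = hbar^2 / 2.\<close>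
    define s where "s = hbar / \<alpha>"
    have s: "0 < s" "s * \<alpha> = hbar" using hbar \<alpha> by (simp_all add: s_def)
    have "W \<bullet> (Jmat *v (s *\<^sub>R U)) = hbar"
      using s(2) by (simp add: inner_Jmat U_def W_def \<alpha>_def inner_commute)
    moreover have "(s *\<^sub>R U) \<bullet> (Sigma *v (s *\<^sub>R U)) = s\<^sup>2 * (U \<bullet> (Sigma *v U))"
      by (simp add: matrix_vector_mult_scaleR power2_eq_square)
    ultimately have "hbar\<^sup>2 \<le> W \<bullet> (Sigma *v W) + s\<^sup>2 * (U \<bullet> (Sigma *v U))"
      using ineq[of W "s *\<^sub>R U"] by (metis power2_eq_square)
    moreover have "s\<^sup>2 * (2 * (U \<bullet> (Sigma *v U))) < s\<^sup>2 * \<alpha>\<^sup>2"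
      using U \<alpha> s(1) by (intro mult_strict_left_mono) auto
    moreover have "s\<^sup>2 * \<alpha>\<^sup>2 = hbar\<^sup>2" using s(2) by (simp flip: power_mult_distrib)
    ultimately show False using W by simp
  qed
  then have pair: "hbar_polar_quantum_pair hbar X P"
    using X P by (auto simp: hbar_polar_quantum_pair_def)
  with hbar_polar_quantum_pair_c_HZ[OF hbar pair] show ?thesis by simp
qed

end
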